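(* Let $(X,\omega,\mu)$ be an infinite, connected weighted graph on which there exists a pseudo metric satisfying property (PM), and endow it with the combinatorial distance $\rho$. Let $f:[0,\infty)\to[0,\infty)$ be a locally Lipschitz, convex function with $f(0)=0$, $f(u)>0$ for all $u>0$, $\int_1^\infty \frac{du}{f(u)}<\infty$ and $\lim_{u\to\infty}\frac{f(u)}{u}=+\infty$. Let $\Omega\subset X$ be a nonempty finite subset and set $$S(r):=\sum_{x\in S_r(\Omega)}\mu(x)\qquad\text{for all } r\in\mathbb{N}_0 .$$ Suppose that (a) $\sup_{x\in X}\mathfrak{D}_+(x)<+\infty$ and $\sup_{x\in X}\mathfrak{D}_-(x)<+\infty$; (b) the series $\sum_{r=0}^{+\infty}S(r)e^{-ar}$ is convergent for some $a>0$. Let $u_0:X\to[0,+\infty)$ be bounded with $u_0\not\equiv0$, and let $u$ be a solution of $u_t-\Delta u=f(u)$ in $X\times(0,T)$, $u=u_0$ in $X\times\{0\}$, with maximal time of existence $T\in(0,+\infty]$. Define, with $a$ as in (b), $$\varphi(x):=C\,e^{-a\,r(x)}\quad\text{for all }x\in X,\qquad C:=\Bigl[\sum_{r=0}^{+\infty}S(r)e^{-ar}\Bigr]^{-1},$$ where $r(x):=\rho(x,\Omega)$, and let $\lambda\ge\sup_{x\in X}\mathfrak{D}_+(x)$. If $$\varphi\,\sup_{t\in(t_0,T')}|u_t(\cdot,t)|\in\ell^1(X,\mu)\qquad\text{for all } t_0,T'\text{ such that }0<t_0<T'<T$$ and $$\sum_{x\in X}u_0(x)\,\varphi(x)\,\mu(x)>s_0(\lambda),\qquad\text{where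 } s_0(\lambda):=\inf\Bigl\{v>0:\ \frac{f(v)}{v}>\lambda\Bigr\},$$ then $u$ blows up in finite time.
   Context: $\mathbb{N}_0=\{0,1,2,\dots\}$. Weighted graph: $X$ is a countably infinite set, $\mu:X\to(0,+\infty)$ (node measure), and $\omega:X\times X\to[0,+\infty)$ (edge weight) satisfies $\omega(x,x)=0$, $\omega(x,y)=\omega(y,x)$ and $\sum_{y\in X}\omega(x,y)<+\infty$ for all $x,y\in X$. One writes $x\sim y$ if $\omega(x,y)>0$. The graph is connected if any two vertices are joined by a finite path of consecutively adjacent vertices. $\ell^1(X,\mu)$ is the set of $g:X\to\mathbb{R}$ with $\sum_{x\in X}|g(x)|\mu(x)<+\infty$; $\ell^\infty(X)$ is the set of bounded functions on $X$, with the sup norm $\|\cdot\|_\infty$. Laplacian: $\Delta g(x):=\frac{1}{\mu(x)}\sum_{y\in X}\omega(x,y)[g(y)-g(x)]$ (well defined for all $g$ here, since property (PM) forces each vertex to have finitely many neighbors); it acts on the space variable of $u(x,t)$. A pseudo metric is a function $d:X\times X\to[0,+\infty)$ with $d(x,x)=0$, $d(x,y)=d(y,x)$ and $d(x,y)\le d(x,z)+d(z,y)$. Property (PM) for $d$: (a) the jump size $s:=\sup\{d(x,y):x\sim y\}$ satisfies $0<s<+\infty$; (b) $\{y:d(y,x)<r\}$ is a finite set for every $x\in X$, $r>0$; (c) there is $C_0>0$ with $\frac{1}{\mu(x)}\sum_{y\in X}\omega(x,y)d(x,y)\le C_0$ for all $x\in X$. The combinatorial distance $\rho(x,y)$ is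 the minimal number of edges in a path connecting $x$ to $y$. For nonempty finite $\Omega\subset X$: $\rho(x,\Omega):=\min_{y\in\Omega}\rho(x,y)$, $r(x):=\rho(x,\Omega)$, and $S_r(\Omega):=\{x\in X:\rho(x,\Omega)=r\}$. Inner and outer degrees with respect to $\Omega$: $\mathfrak{D}_-(x):=0$ if $r(x)=0$ and $\mathfrak{D}_-(x):=\frac1{\mu(x)}\sum_{y\in S_{r(x)-1}(\Omega)}\omega(x,y)$ if $r(x)\ge1$; $\mathfrak{D}_+(x):=\frac1{\mu(x)}\sum_{y\in S_{r(x)+1}(\Omega)}\omega(x,y)$ for all $x\in X$. Solution: a function $u:X\times[0,T)\to\mathbb{R}$ with $u(x,\cdot)\in C^1((0,T))\cap C^0([0,T))$ for all $x\in X$, $u\in L^\infty(X\times[0,T'])$ for all $T'\in(0,T)$, $u\ge0$ in $X\times(0,T)$, and satisfying the equation and the initial condition pointwise. The solution is considered up to its maximal time of existence $T\in(0,+\infty]$, and by convention exactly one of two alternatives holds: either $T=+\infty$ and $u(\cdot,t)\in\ell^\infty(X)$ for all $t>0$ ($u$ is global), or $T<+\infty$ and $\lim_{t\to T^-}\|u(\cdot,t)\|_\infty=+\infty$. "$u$ blows up in finite time" means that the maximal time of existence is finite, $0<T<+\infty$, with $u(\cdot,t)\in\ell^\infty(X)$ for all $t\in(0,T)$ and $\lim_{t\to T^-}\|u(\cdot,t)\|_\infty=+\infty$. *)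

theory Defs
  imports "HOL-Analysis.Analysis"
begin

text \<open>
  The vertex set is a whole type, required to be countably infinite.
\<close>

locale weighted_graph =
  fixes \<mu> :: "'a \<Rightarrow> real" and \<omega> :: "'a \<Rightarrow> 'a \<Rightarrow> real"
  assumes countable_vertices: "countable (UNIV :: 'a set)"
    and infinite_vertices: "infinite (UNIV :: 'a set)"
    and measure_pos: "\<mu> x > 0"
    and weight_nonneg: "\<omega> x y \<ge> 0"
    and weight_diag: "\<omega> x x = 0"
    and weight_sym: "\<omega> x y = \<omega> y x"
    and weight_summable: "(\<lambda>y. \<omega> x y) summable_on UNIV"

definition adj :: "('a \<Rightarrow> 'a \<Rightarrow> real) \<Rightarrow> 'a \<Rightarrow> 'a \<Rightarrow> bool" where
  "adj \<omega> x y \<longleftrightarrow> \<omega> x y > 0"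

text \<open>
  The relational power \<open>(adj \<omega> ^^ n) x y\<close> says that \<open>x\<close> and \<open>y\<close> are joined by a
  path with \<open>n\<close> edges.
\<close>

definition connected_graph :: "('a \<Rightarrow> 'a \<Rightarrow> real) \<Rightarrow> bool" where
  "connected_graph \<omega> \<longleftrightarrow> (\<forall>x y. \<exists>n. (adj \<omega> ^^ n) x y)"

definition comb_dist :: "('a \<Rightarrow> 'a \<Rightarrow> real) \<Rightarrow> 'a \<Rightarrow> 'a \<Rightarrow> nat" where
  "comb_dist \<omega> x y = (LEAST n. (adj \<omega> ^^ n) x y)"

definition set_dist :: "('a \<Rightarrow> 'a \<Rightarrow> real) \<Rightarrow> 'a set \<Rightarrow> 'a \<Rightarrow> nat" where
  "set_dist \<omega> \<Omega> x = Min (comb_dist \<omega> x ` \<Omega>)"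

definition dist_sphere :: "('a \<Rightarrow> 'a \<Rightarrow> real) \<Rightarrow> 'a set \<Rightarrow> nat \<Rightarrow> 'a set" where
  "dist_sphere \<omega> \<Omega> r = {x. set_dist \<omega> \<Omega> x = r}"

definition inner_degree ::
    "('a \<Rightarrow> real) \<Rightarrow> ('a \<Rightarrow> 'a \<Rightarrow> real) \<Rightarrow> 'a set \<Rightarrow> 'a \<Rightarrow> real" where
  "inner_degree \<mu> \<omega> \<Omega> x =
     (if set_dist \<omega> \<Omega> x = 0 then 0
      else 1 / \<mu> x * (\<Sum>\<^sub>\<infinity>y\<in>dist_sphere \<omega> \<Omega> (set_dist \<omega> \<Omega> x - 1). \<omega> x y))"

definition outer_degree ::
    "('a \<Rightarrow> real) \<Rightarrow> ('a \<Rightarrow> 'a \<Rightarrow> real) \<Rightarrow> 'a set \<Rightarrow> 'a \<Rightarrow> real" where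
  "outer_degree \<mu> \<omega> \<Omega> x =
     1 / \<mu> x * (\<Sum>\<^sub>\<infinity>y\<in>dist_sphere \<omega> \<Omega> (set_dist \<omega> \<Omega> x + 1). \<omega> x y)"

definition sphere_measure ::
    "('a \<Rightarrow> real) \<Rightarrow> ('a \<Rightarrow> 'a \<Rightarrow> real) \<Rightarrow> 'a set \<Rightarrow> nat \<Rightarrow> real" where
  "sphere_measure \<mu> \<omega> \<Omega> r = (\<Sum>\<^sub>\<infinity>x\<in>dist_sphere \<omega> \<Omega> r. \<mu> x)"

text \<open>
  Property (PM) below forces finite neighbourhoods, so this sum has only finitely many nonzero
  terms there.
\<close>

definition laplacian ::
    "('a \<Rightarrow> real) \<Rightarrow> ('a \<Rightarrow> 'a \<Rightarrow> real) \<Rightarrow> ('a \<Rightarrow> real) \<Rightarrow> 'a \<Rightarrow> real" where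
  "laplacian \<mu> \<omega> g x = 1 / \<mu> x * (\<Sum>\<^sub>\<infinity>y. \<omega> x y * (g y - g x))"

definition ell1 :: "('a \<Rightarrow> real) \<Rightarrow> ('a \<Rightarrow> real) set" where
  "ell1 \<mu> = {g. (\<lambda>x. \<bar>g x\<bar> * \<mu> x) summable_on UNIV}"

definition ell_inf :: "('a \<Rightarrow> real) set" where
  "ell_inf = {g. bounded (range g)}"

definition sup_norm :: "('a \<Rightarrow> real) \<Rightarrow> real" where
  "sup_norm g = (SUP x. \<bar>g x\<bar>)"

definition pseudo_metric :: "('a \<Rightarrow> 'a \<Rightarrow> real) \<Rightarrow> bool" where
  "pseudo_metric d \<longleftrightarrow>
     (\<forall>x y. d x y \<ge> 0) \<and> (\<forall>x. d x x = 0) \<and> (\<forall>x y. d x y = d y x) \<and>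
     (\<forall>x y z. d x y \<le> d x z + d z y)"

definition jump_size :: "('a \<Rightarrow> 'a \<Rightarrow> real) \<Rightarrow> ('a \<Rightarrow> 'a \<Rightarrow> real) \<Rightarrow> ereal" where
  "jump_size \<omega> d = Sup {ereal (d x y) | x y. adj \<omega> x y}"

text \<open>
  In the last clause the series converges because \<open>d\<close> is bounded by the jump size on
  edges, so \<open>infsum\<close> never takes its default value there.
\<close>

definition property_PM ::
    "('a \<Rightarrow> real) \<Rightarrow> ('a \<Rightarrow> 'a \<Rightarrow> real) \<Rightarrow> ('a \<Rightarrow> 'a \<Rightarrow> real) \<Rightarrow> bool" where
  "property_PM \<mu> \<omega> d \<longleftrightarrow>
     (0 < jump_size \<omega> d \<and> jump_size \<omega> d < \<infinity>) \<and>
     (\<forall>x. \<forall>r>0. finite {y. d y x < r}) \<and>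
     (\<exists>C0>0. \<forall>x. 1 / \<mu> x * (\<Sum>\<^sub>\<infinity>y. \<omega> x y * d x y) \<le> C0)"

definition locally_lipschitz_on :: "real set \<Rightarrow> (real \<Rightarrow> real) \<Rightarrow> bool" where
  "locally_lipschitz_on S f \<longleftrightarrow>
     (\<forall>x\<in>S. \<exists>e>0. \<exists>L. L-lipschitz_on (cball x e \<inter> S) f)"

text \<open>
  A function on \<open>X \<times> [0,T)\<close> is a total function of which only the values at times in
  \<open>[0,T)\<close> are constrained. Since \<open>\<mu>\<close> is positive and each \<open>u x\<close> is continuous, membership in
  \<open>L\<^sup>\<infinity>(X \<times> [0,T'])\<close> is plain boundedness.
\<close>

definition is_solution ::
    "('a \<Rightarrow> real) \<Rightarrow> ('a \<Rightarrow> 'a \<Rightarrow> real) \<Rightarrow> (real \<Rightarrow> real) \<Rightarrow> ('a \<Rightarrow> real) \<Rightarrow>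
     ereal \<Rightarrow> ('a \<Rightarrow> real \<Rightarrow> real) \<Rightarrow> bool" where
  "is_solution \<mu> \<omega> f u0 T u \<longleftrightarrow>
     0 < T \<and>
     (\<forall>x. u x C1_differentiable_on {t. 0 < t \<and> ereal t < T}) \<and>
     (\<forall>x. continuous_on {t. 0 \<le> t \<and> ereal t < T} (u x)) \<and>
     (\<forall>T'. 0 < T' \<and> ereal T' < T \<longrightarrow> bounded ((\<lambda>(x, t). u x t) ` (UNIV \<times> {0..T'}))) \<and>
     (\<forall>x t. 0 < t \<and> ereal t < T \<longrightarrow> u x t \<ge> 0) \<and>
     (\<forall>x t. 0 < t \<and> ereal t < T \<longrightarrow>
        deriv (u x) t - laplacian \<mu> \<omega> (\<lambda>y. u y t) x = f (u x t)) \<and>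
     (\<forall>x. u x 0 = u0 x)"

definition global_in_time :: "ereal \<Rightarrow> ('a \<Rightarrow> real \<Rightarrow> real) \<Rightarrow> bool" where
  "global_in_time T u \<longleftrightarrow> T = \<infinity> \<and> (\<forall>t>0. (\<lambda>x. u x t) \<in> ell_inf)"

definition blows_up_in_finite_time :: "ereal \<Rightarrow> ('a \<Rightarrow> real \<Rightarrow> real) \<Rightarrow> bool" where
  "blows_up_in_finite_time T u \<longleftrightarrow>
     0 < T \<and> T < \<infinity> \<and>
     (\<forall>t. 0 < t \<and> ereal t < T \<longrightarrow> (\<lambda>x. u x t) \<in> ell_inf) \<and>
     filterlim (\<lambda>t. sup_norm (\<lambda>x. u x t)) at_top (at_left (real_of_ereal T))"

text \<open>
  That \<open>T\<close> is the maximal existence time of \<open>u\<close> means, by convention, that either the solution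
  is global or its sup norm tends to infinity at the finite time \<open>T\<close>; in the latter case it
  has no continuation to a solution on a longer interval.
\<close>

definition is_maximal_solution ::
    "('a \<Rightarrow> real) \<Rightarrow> ('a \<Rightarrow> 'a \<Rightarrow> real) \<Rightarrow> (real \<Rightarrow> real) \<Rightarrow> ('a \<Rightarrow> real) \<Rightarrow>
     ereal \<Rightarrow> ('a \<Rightarrow> real \<Rightarrow> real) \<Rightarrow> bool" where
  "is_maximal_solution \<mu> \<omega> f u0 T u \<longleftrightarrow>
     is_solution \<mu> \<omega> f u0 T u \<and>
     (global_in_time T u \<or>
      (T < \<infinity> \<and> filterlim (\<lambda>t. sup_norm (\<lambda>x. u x t)) at_top (at_left (real_of_ereal T))))"

definition exp_weight ::
    "('a \<Rightarrow> real) \<Rightarrow> ('a \<Rightarrow> 'a \<Rightarrow> real) \<Rightarrow> 'a set \<Rightarrow> real \<Rightarrow> 'a \<Rightarrow> real" where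
  "exp_weight \<mu> \<omega> \<Omega> a x =
     inverse (\<Sum>r. sphere_measure \<mu> \<omega> \<Omega> r * exp (- a * real r)) *
     exp (- a * real (set_dist \<omega> \<Omega> x))"

definition s_zero :: "(real \<Rightarrow> real) \<Rightarrow> real \<Rightarrow> real" where
  "s_zero f l = Inf {v. v > 0 \<and> f v / v > l}"

end

theory Submission
  imports Defs
begin

text \<open>
  The idea is Kaplan's: follow the weighted mass \<open>y t = (\<Sum>x. u x t * \<phi> x * \<mu> x)\<close>, where
  \<open>\<phi>\<close> decays exponentially in the distance \<open>r\<close> from \<open>\<Omega>\<close> and \<open>\<phi> * \<mu>\<close> has total mass one.
  Across an edge \<open>r\<close> changes by at most one, so \<open>\<phi>\<close> can only drop on the outer neighbours, and
  drops there by at most \<open>\<phi> x\<close>. Hence \<open>\<Delta>\<phi> \<ge> - l * \<phi>\<close> as soon as \<open>l\<close> bounds the outer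
  degree. Moving the Laplacian onto \<open>\<phi>\<close> and applying Jensen's inequality to the reaction term
  suggests \<open>y' \<ge> f y - l * y\<close>. Since \<open>f v / v\<close> is nondecreasing, \<open>f v - l * v\<close> dominates a
  fixed multiple of \<open>f v\<close> on \<open>[c, \<infinity>)\<close> for any \<open>c\<close> with \<open>f c / c > l\<close>; as \<open>1 / f\<close> is integrable
  at infinity, a function that starts above such a \<open>c\<close> and satisfies the inequality cannot live
  for arbitrarily long (\<open>osgood_no_long_solution\<close>).

  To make this rigorous every sum is kept finite: \<open>\<phi>\<close> is replaced by \<open>\<eta> * \<phi>\<close>, where
  \<open>\<eta> x = max 0 (1 - d x q / R)\<close> is a cutoff in the pseudo metric, whose balls are finite.
  The cutoff is \<open>1 / R\<close>-Lipschitz for \<open>d\<close>, and the mean jump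
  \<open>(\<Sum>y. \<omega> x y * d x y) / \<mu> x\<close> is at most \<open>C0\<close>, so it spoils the Laplacian estimate only by
  \<open>exp a * C0 / R * \<phi>\<close> (\<open>laplacian_cutoff_exp_weight_ge\<close>). If \<open>u \<le> M\<close>, the truncated mass
  therefore satisfies \<open>y' \<ge> f y - l * y - exp a * C0 * M / R\<close> (\<open>truncated_mass_growth\<close>).

  The order of the choices matters. If \<open>u\<close> were global, one would first fix \<open>c\<close> below the initial
  mass, then a time \<open>\<tau>\<close> longer than the scalar inequality allows, then a bound \<open>M\<close> for \<open>u\<close> up to
  time \<open>\<tau>\<close>, and only then \<open>R\<close>, so large that the truncated initial mass still exceeds \<open>c\<close> and the
  error is absorbed by half of the reaction term. The truncated mass would then exist up to
  time \<open>\<tau>\<close>, which is impossible; and by the maximality convention a solution that is not global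
  blows up.
\<close>

section \<open>Convex reaction terms and the scalar differential inequality\<close>

text \<open>
  Jensen's inequality survives when the weights sum to less than one: the missing mass is
  placed at the point \<open>0\<close>, where \<open>f\<close> vanishes. The index \<open>None\<close> carries that point in the proof.
\<close>

lemma convex_on_subprobability_sum:
  fixes f :: "real \<Rightarrow> real"
  assumes "convex_on {0..} f" "f 0 = 0" "finite K"
    and w: "\<And>x. x \<in> K \<Longrightarrow> 0 \<le> w x" "(\<Sum>x\<in>K. w x) \<le> 1"
    and v: "\<And>x. x \<in> K \<Longrightarrow> 0 \<le> v x"
  shows "f (\<Sum>x\<in>K. w x * v x) \<le> (\<Sum>x\<in>K. w x * f (v x))"
proof -
  define S where "S = insert None (Some ` K)"
  define w' where "w' z = (case z of None \<Rightarrow> 1 - (\<Sum>x\<in>K. w x) | Some x \<Rightarrow> w x)" for z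
  define v' where "v' z = (case z of None \<Rightarrow> 0 | Some x \<Rightarrow> v x)" for z
  have S: "sum g S = g None + (\<Sum>x\<in>K. g (Some x))" for g :: "_ \<Rightarrow> real"
    using assms(3) by (simp add: S_def sum.reindex)
  have "f (\<Sum>z\<in>S. w' z *\<^sub>R v' z) \<le> (\<Sum>z\<in>S. w' z * f (v' z))"
  proof (rule convex_on_sum[OF _ _ assms(1)])
    show "sum w' S = 1" by (simp add: S w'_def)
    show "w' z \<ge> 0" "v' z \<in> {0..}" if "z \<in> S" for z
      using that w v by (auto simp: S_def w'_def v'_def)
  qed (use assms(3) in \<open>simp_all add: S_def\<close>)
  then show ?thesis
    by (simp add: S w'_def v'_def assms(2))
qed

lemma convex_on_slope_mono:
  fixes f :: "real \<Rightarrow> real"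
  assumes "convex_on {0..} f" "f 0 = 0" "0 < v" "v \<le> w"
  shows "f v / v \<le> f w / w"
proof -
  have "f ((1 - v/w) *\<^sub>R 0 + (v/w) *\<^sub>R w) \<le> (1 - v/w) * f 0 + (v/w) * f w"
    using assms by (intro convex_onD[OF assms(1)]) auto
  then show ?thesis using assms by (simp add: field_simps)
qed

text \<open>
  Once the slope \<open>f v / v\<close> exceeds \<open>l\<close> it stays above, so the fraction of \<open>f v\<close> that the linear
  loss can consume is largest at \<open>v = c\<close>; this gives \<open>k = 1 - l * c / f c\<close>.
\<close>

lemma convex_reaction_beats_linear:
  fixes f :: "real \<Rightarrow> real"
  assumes "convex_on {0..} f" "f 0 = 0" "0 < c" "l < f c / c" "0 \<le> l"
  obtains k where "0 < k" "\<And>v. c \<le> v \<Longrightarrow> f c \<le> f v \<and> k * f v \<le> f v - l * v"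
proof
  have fc: "l * c < f c" using assms(3,4) by (simp add: field_simps)
  then have "0 < f c" using assms(3,5) by (smt (verit) mult_nonneg_nonneg)
  then show "0 < 1 - l * c / f c" using fc by simp
  fix v assume "c \<le> v"
  then have slope: "f c * v \<le> f v * c"
    using convex_on_slope_mono[OF assms(1-3)] assms(3) by (simp add: field_simps)
  have "f c * c \<le> f c * v" using \<open>c \<le> v\<close> \<open>0 < f c\<close> by simp
  with slope have "f c * c \<le> f v * c" by linarith
  moreover have "l * v \<le> l * c / f c * f v"
    using mult_left_mono[OF slope assms(5)] \<open>0 < f c\<close> by (simp add: field_simps)
  ultimately show "f c \<le> f v \<and> (1 - l * c / f c) * f v \<le> f v - l * v"
    using assms(3) by (simp add: left_diff_distrib)
qed

lemma continuous_on_locally_lipschitz: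
  fixes f :: "real \<Rightarrow> real"
  assumes "locally_lipschitz_on S f"
  shows "continuous_on S f"
  unfolding continuous_on_eq_continuous_within
proof
  fix x assume "x \<in> S"
  then obtain e L where "e > 0" "L-lipschitz_on (cball x e \<inter> S) f"
    using assms unfolding locally_lipschitz_on_def by blast
  then have "continuous_on (cball x e \<inter> S) f" by (blast intro: lipschitz_on_continuous_on)
  then have "continuous (at x within (S \<inter> cball x e)) f"
    using \<open>x \<in> S\<close> \<open>e > 0\<close> by (simp add: continuous_on_eq_continuous_within Int_commute)
  moreover have "at x within (S \<inter> cball x e) = at x within S"
    using \<open>e > 0\<close> by (intro at_within_nhd[of _ "ball x e"]) auto
  ultimately show "continuous (at x within S) f" by simp
qed

text \<open>
  The function \<open>G v\<close> is the time that \<open>y' = f y\<close> needs to climb from \<open>c\<close> to \<open>v\<close>; integrability of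
  \<open>1 / f\<close> at infinity makes this time bounded.
\<close>

lemma bounded_antiderivative_reciprocal:
  fixes f :: "real \<Rightarrow> real"
  assumes "continuous_on {0..} f" "\<forall>v>0. f v > 0"
    and "set_integrable lborel {1..} (\<lambda>v. 1 / f v)" and "c > 0"
  obtains G B where "\<And>v. c \<le> v \<Longrightarrow> 0 \<le> G v \<and> G v \<le> B"
    and "\<And>v. c < v \<Longrightarrow> (G has_real_derivative 1 / f v) (at v)"
proof
  let ?g = "\<lambda>v. 1 / f v"
  let ?G = "\<lambda>v. integral {c..v} ?g"
  let ?b = "max c 1"
  have cont: "continuous_on {c..b} ?g" for b
  proof (rule continuous_on_divide)
    show "continuous_on {c..b} f" using assms(1,4) by (auto intro: continuous_on_subset)
    show "\<forall>v\<in>{c..b}. f v \<noteq> 0"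
    proof
      fix v assume "v \<in> {c..b}"
      then have "f v > 0" using assms(2,4) by simp
      then show "f v \<noteq> 0" by simp
    qed
  qed auto
  then have int: "?g integrable_on {p..q}" if "c \<le> p" for p q
    using that by (intro integrable_continuous_real continuous_on_subset[OF cont[of q]]) auto
  have nonneg: "0 \<le> ?g v" if "c \<le> v" for v
    using assms(2,4) that by (simp add: less_imp_le)
  have tail: "?g integrable_on {1..}" by (rule set_borel_integral_eq_integral(1)[OF assms(3)])
  fix v :: real
  show "0 \<le> ?G v \<and> ?G v \<le> integral {c..?b} ?g + integral {1..} ?g" if "c \<le> v"
  proof
    show "0 \<le> ?G v" using nonneg by (intro integral_nonneg int) auto
    have tail0: "0 \<le> integral {1..} ?g"
      using assms(2) by (intro integral_nonneg tail) (auto simp: less_imp_le)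
    show "?G v \<le> integral {c..?b} ?g + integral {1..} ?g"
    proof (cases "v \<le> ?b")
      case True
      have "?G v \<le> integral {c..?b} ?g"
        using True nonneg by (intro integral_subset_le int) auto
      with tail0 show ?thesis by linarith
    next
      case False
      have "?G v = integral {c..?b} ?g + integral {?b..v} ?g"
        using False by (intro Henstock_Kurzweil_Integration.integral_combine[symmetric] int) auto
      moreover have "integral {?b..v} ?g \<le> integral {1..} ?g"
        using assms(2) by (intro integral_subset_le int tail) (auto simp: less_imp_le)
      ultimately show ?thesis by linarith
    qed
  qed
  show "(?G has_real_derivative ?g v) (at v)" if "c < v"
  proof -
    have "(?G has_real_derivative ?g v) (at v within {c..v + 1})"
      using that by (intro integral_has_real_derivative cont) simp
    moreover have "at v within {c..v + 1} = at v"
      using that by (intro at_within_interior) simp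
    ultimately show ?thesis by simp
  qed
qed

text \<open>
  As long as \<open>y > c\<close>, the function \<open>G \<circ> y\<close> grows at rate at least \<open>k\<close>, yet it never exceeds
  the bound \<open>B\<close> of \<open>G\<close>. The time \<open>\<tau>\<close> depends on \<open>f\<close>, \<open>c\<close> and \<open>k\<close> but not on \<open>y\<close>, which
  later allows the truncation radius to be chosen after \<open>\<tau>\<close>.
\<close>

lemma osgood_no_long_solution:
  fixes f :: "real \<Rightarrow> real"
  assumes "continuous_on {0..} f" "\<forall>v>0. f v > 0"
    and "set_integrable lborel {1..} (\<lambda>v. 1 / f v)" and "c > 0" "k > 0"
  obtains \<tau> where "\<tau> > 0"
    and "\<And>y. \<lbrakk>continuous_on {0..\<tau>} y; c < y 0;
            \<And>t. 0 < t \<Longrightarrow> t < \<tau> \<Longrightarrow>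
              \<exists>D. (y has_real_derivative D) (at t) \<and> (c < y t \<longrightarrow> k * f (y t) \<le> D)\<rbrakk> \<Longrightarrow> False"
proof -
  obtain G B where GB: "\<And>v. c \<le> v \<Longrightarrow> 0 \<le> G v \<and> G v \<le> B"
    and G': "\<And>v. c < v \<Longrightarrow> (G has_real_derivative 1 / f v) (at v)"
    using bounded_antiderivative_reciprocal[OF assms(1-4)] by blast
  define \<tau> where "\<tau> = (B + 1) / k"
  have "B \<ge> 0" using GB[of c] by simp
  then have "\<tau> > 0" using \<open>k > 0\<close> by (simp add: \<tau>_def)
  moreover have False
    if y: "continuous_on {0..\<tau>} y" "c < y 0"
      and y': "\<And>t. 0 < t \<Longrightarrow> t < \<tau> \<Longrightarrow>
              \<exists>D. (y has_real_derivative D) (at t) \<and> (c < y t \<longrightarrow> k * f (y t) \<le> D)" for y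
  proof -
    have above: "c < y t" if t: "t \<in> {0..\<tau>}" for t
    proof (rule ccontr)
      (* y is nondecreasing up to the first time s at which it is at most c,
         so it cannot have come down to c from y 0 *)
      let ?Z = "{0..\<tau>} \<inter> y -` {..c}"
      assume "\<not> c < y t"
      then have "?Z \<noteq> {}" using t by auto
      moreover have "compact ?Z"
        using continuous_closed_preimage[OF y(1) closed_real_atLeastAtMost closed_atMost]
        by (simp add: compact_eq_bounded_closed bounded_Int)
      ultimately obtain s where s: "s \<in> ?Z" and first: "\<And>r. r \<in> ?Z \<Longrightarrow> s \<le> r"
        using compact_attains_inf by metis
      have "y 0 \<le> y s"
      proof (rule DERIV_nonneg_imp_increasing_open[where f = y])
        show "continuous_on {0..s} y" using y(1) s by (auto intro: continuous_on_subset)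
        fix r assume r: "0 < r" "r < s"
        have "c < y r"
        proof (rule ccontr)
          assume "\<not> c < y r"
          then have "s \<le> r" using r s by (intro first) auto
          with r show False by simp
        qed
        moreover from r s have "r < \<tau>" by auto
        moreover have "0 \<le> k * f (y r)"
          using \<open>c < y r\<close> assms(2,4,5) by (simp add: less_imp_le)
        ultimately show "\<exists>D. (y has_real_derivative D) (at r) \<and> D \<ge> 0"
          using y'[OF r(1)] by (meson order_trans)
      qed (use s in auto)
      then show False using s y(2) by auto
    qed
    have "G (y 0) - k * 0 \<le> G (y \<tau>) - k * \<tau>"
    proof (rule DERIV_nonneg_imp_increasing_open[where f = "\<lambda>t. G (y t) - k * t"])
      show "continuous_on {0..\<tau>} (\<lambda>t. G (y t) - k * t)"
      proof (intro continuous_intros continuous_on_compose2[OF _ y(1)])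
        show "continuous_on {c<..} G"
          using G' by (auto intro!: continuous_at_imp_continuous_on DERIV_isCont)
        show "y ` {0..\<tau>} \<subseteq> {c<..}" using above by auto
      qed
      fix t assume t: "0 < t" "t < \<tau>"
      then have c: "c < y t" using above by auto
      with y'[OF t] obtain D where D: "(y has_real_derivative D) (at t)" "k * f (y t) \<le> D" by blast
      have "f (y t) > 0" using c assms(2,4) by auto
      have "((\<lambda>t. G (y t) - k * t) has_real_derivative (1 / f (y t) * D - k)) (at t)"
        by (rule derivative_eq_intros DERIV_chain2[OF G'[OF c] D(1)] | simp)+
      moreover have "1 / f (y t) * D - k \<ge> 0"
        using D(2) \<open>f (y t) > 0\<close> by (simp add: field_simps)
      ultimately show "\<exists>E. ((\<lambda>t. G (y t) - k * t) has_real_derivative E) (at t) \<and> E \<ge> 0" by blast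
    qed (use \<open>\<tau> > 0\<close> in auto)
    moreover have "0 \<le> G (y 0)" "G (y \<tau>) \<le> B"
      using GB above \<open>\<tau> > 0\<close> by (simp_all add: less_imp_le)
    ultimately show False using \<open>k > 0\<close> by (simp add: \<tau>_def)
  qed
  ultimately show thesis using that by blast
qed

section \<open>Cutoff functions of a pseudo metric\<close>

definition cutoff :: "('a \<Rightarrow> 'a \<Rightarrow> real) \<Rightarrow> 'a \<Rightarrow> real \<Rightarrow> 'a \<Rightarrow> real" where
  "cutoff d q R x = max 0 (1 - d x q / R)"

lemma cutoff_bounds:
  assumes "pseudo_metric d" "R > 0"
  shows "0 \<le> cutoff d q R x" "cutoff d q R x \<le> 1"
  using assms by (auto simp: cutoff_def pseudo_metric_def)

lemma cutoff_lipschitz: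
  assumes "pseudo_metric d" "R > 0"
  shows "cutoff d q R x - d x y / R \<le> cutoff d q R y"
proof -
  have "d y q \<le> d x y + d x q" "0 \<le> d x y" using assms(1) unfolding pseudo_metric_def by metis+
  then have "d y q / R \<le> (d x y + d x q) / R" "0 \<le> d x y / R"
    using assms(2) by (simp_all add: divide_right_mono)
  then show ?thesis by (auto simp: cutoff_def add_divide_distrib)
qed

text \<open>
  Monotone convergence for the truncation: the cutoffs tend to one pointwise, and a finite part
  of the series already exceeds \<open>c\<close>. The bound \<open>0 \<le> c\<close> matters, because \<open>infsum\<close> is \<open>0\<close> on a
  divergent series, so only a nonnegative \<open>c\<close> below it forces convergence.
\<close>

lemma eventually_truncated_sum_greater:
  fixes g :: "'a \<Rightarrow> real"
  assumes "\<And>x. 0 \<le> g x" "0 \<le> c" "c < (\<Sum>\<^sub>\<infinity>x. g x)"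
    and fin: "\<And>R. 0 < R \<Longrightarrow> finite {x. d x q < R}"
  shows "\<forall>\<^sub>F R in at_top. c < (\<Sum>x | d x q < R. cutoff d q R x * g x)"
proof -
  have "g summable_on UNIV"
    using assms(2,3) infsum_not_exists[of g UNIV] by force
  then have "(sum g \<longlongrightarrow> (\<Sum>\<^sub>\<infinity>x. g x)) (finite_subsets_at_top UNIV)"
    using has_sum_infsum has_sum_def by blast
  then have "\<forall>\<^sub>F F in finite_subsets_at_top UNIV. c < sum g F"
    using assms(3) by (rule order_tendstoD)
  then obtain F where F: "finite F" "c < sum g F"
    by (auto simp: eventually_finite_subsets_at_top)
  have "((\<lambda>R. \<Sum>x\<in>F. cutoff d q R x * g x) \<longlongrightarrow> (\<Sum>x\<in>F. max 0 (1 - 0) * g x)) at_top"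
    unfolding cutoff_def
    by (intro tendsto_intros real_tendsto_divide_at_top[OF tendsto_const filterlim_ident])
  then have "\<forall>\<^sub>F R in at_top. c < (\<Sum>x\<in>F. cutoff d q R x * g x)"
    using F(2) by (intro order_tendstoD(1)) auto
  with eventually_gt_at_top[of 0] show ?thesis
  proof eventually_elim
    case (elim R)
    let ?K = "{x. d x q < R}"
    have "(\<Sum>x\<in>F. cutoff d q R x * g x) \<le> (\<Sum>x\<in>F \<union> ?K. cutoff d q R x * g x)"
      using F(1) fin[OF elim(1)] assms(1) by (intro sum_mono2) (auto simp: cutoff_def)
    also have "\<dots> = (\<Sum>x\<in>?K. cutoff d q R x * g x)"
      using F(1) fin[OF elim(1)] elim(1)
      by (intro sum.mono_neutral_right) (auto simp: cutoff_def not_less)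
    finally show ?case using elim(2) by linarith
  qed
qed

section \<open>Local finiteness, the Laplacian and Green's formula\<close>

context weighted_graph
begin

lemma weight_eq_0_iff_not_adj: "\<omega> x y = 0 \<longleftrightarrow> \<not> adj \<omega> x y"
  using weight_nonneg[of x y] by (auto simp: adj_def)

lemma adj_sym: "adj \<omega> x y \<Longrightarrow> adj \<omega> y x"
  by (simp add: adj_def weight_sym)

lemma edge_length_bounded:
  assumes "property_PM \<mu> \<omega> d"
  obtains s where "\<And>x y. adj \<omega> x y \<Longrightarrow> d x y \<le> s"
proof -
  from assms have "0 < jump_size \<omega> d" "jump_size \<omega> d < \<infinity>" by (auto simp: property_PM_def)
  then obtain s where s: "jump_size \<omega> d = ereal s" by (cases "jump_size \<omega> d") auto
  have "d x y \<le> s" if "adj \<omega> x y" for x y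
  proof -
    have "ereal (d x y) \<le> jump_size \<omega> d"
      unfolding jump_size_def using that by (intro Sup_upper) blast
    then show ?thesis by (simp add: s)
  qed
  then show thesis by (rule that)
qed

text \<open>
  All neighbours lie in a ball of radius slightly larger than the jump size, and balls are finite.
\<close>

lemma locally_finite:
  assumes "property_PM \<mu> \<omega> d"
  shows "finite {y. adj \<omega> x y}"
proof -
  obtain s where s: "\<And>x y. adj \<omega> x y \<Longrightarrow> d x y \<le> s"
    using edge_length_bounded[OF assms] by blast
  have "{y. adj \<omega> x y} \<subseteq> {y. d y x < \<bar>s\<bar> + 1}"
    using s adj_sym by force
  moreover have "finite {y. d y x < \<bar>s\<bar> + 1}"
    using assms by (auto simp: property_PM_def)
  ultimately show ?thesis by (rule finite_subset)
qed

text \<open>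
  The finite set \<open>N\<close> may be larger than the neighbourhood, so that sums at different vertices can
  be taken over a common range.
\<close>

lemma infsum_weight_eq_sum:
  assumes "finite N" "{y. adj \<omega> x y} \<subseteq> N"
  shows "infsum (\<lambda>y. \<omega> x y * g y) A = (\<Sum>y\<in>N \<inter> A. \<omega> x y * g y)"
proof -
  have "infsum (\<lambda>y. \<omega> x y * g y) A = infsum (\<lambda>y. \<omega> x y * g y) (N \<inter> A)"
    using assms(2) by (intro infsum_cong_neutral) (auto simp: weight_eq_0_iff_not_adj)
  then show ?thesis using assms(1) by simp
qed

lemma laplacian_eq_sum:
  assumes "finite N" "{y. adj \<omega> x y} \<subseteq> N"
  shows "\<mu> x * laplacian \<mu> \<omega> g x = (\<Sum>y\<in>N. \<omega> x y * (g y - g x))"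
  using infsum_weight_eq_sum[OF assms, of "\<lambda>y. g y - g x" UNIV] measure_pos[of x]
  by (simp add: laplacian_def)

text \<open>
  With \<open>N\<close> the support together with its neighbours, both sides are finite double sums over
  \<open>N \<times> N\<close> exchanged by the symmetry of the weight. A vertex of \<open>N\<close> outside \<open>K\<close> may have
  neighbours outside \<open>N\<close>, but \<open>\<psi>\<close> vanishes at both ends of such an edge.
\<close>

lemma green_formula_finite_support:
  assumes lf: "\<And>x. finite {y. adj \<omega> x y}" and K: "finite K" "\<And>x. x \<notin> K \<Longrightarrow> \<psi> x = 0"
  obtains N where "finite N" "K \<subseteq> N"
    and "(\<Sum>x\<in>K. \<psi> x * \<mu> x * laplacian \<mu> \<omega> v x) = (\<Sum>x\<in>N. v x * \<mu> x * laplacian \<mu> \<omega> \<psi> x)"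
proof -
  define N where "N = K \<union> (\<Union>x\<in>K. {y. adj \<omega> x y})"
  have N: "finite N" "K \<subseteq> N" using lf K(1) by (auto simp: N_def)
  let ?M = "\<lambda>x. N \<union> {y. adj \<omega> x y}"
  have \<psi>N: "\<psi> x = 0" if "x \<notin> N" for x using that N(2) K(2) by blast
  have "(\<Sum>x\<in>K. \<psi> x * \<mu> x * laplacian \<mu> \<omega> v x) = (\<Sum>x\<in>K. \<Sum>y\<in>N. \<omega> x y * (\<psi> x * (v y - v x)))"
  proof (rule sum.cong)
    fix x assume "x \<in> K"
    then have "\<mu> x * laplacian \<mu> \<omega> v x = (\<Sum>y\<in>N. \<omega> x y * (v y - v x))"
      by (intro laplacian_eq_sum N(1)) (auto simp: N_def)
    then have "\<psi> x * (\<mu> x * laplacian \<mu> \<omega> v x) = \<psi> x * (\<Sum>y\<in>N. \<omega> x y * (v y - v x))"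
      by simp
    then show "\<psi> x * \<mu> x * laplacian \<mu> \<omega> v x = (\<Sum>y\<in>N. \<omega> x y * (\<psi> x * (v y - v x)))"
      by (simp only: sum_distrib_left mult_ac)
  qed simp
  also have "\<dots> = (\<Sum>x\<in>N. \<Sum>y\<in>N. \<omega> x y * (\<psi> x * (v y - v x)))"
    using N K(2) by (intro sum.mono_neutral_left) auto
  also have "\<dots> = (\<Sum>x\<in>N. \<Sum>y\<in>N. \<omega> x y * (\<psi> x * v y)) - (\<Sum>x\<in>N. \<Sum>y\<in>N. \<omega> x y * (\<psi> x * v x))"
    by (simp add: algebra_simps sum_subtractf)
  also have "(\<Sum>x\<in>N. \<Sum>y\<in>N. \<omega> x y * (\<psi> x * v y)) = (\<Sum>x\<in>N. \<Sum>y\<in>N. \<omega> x y * (\<psi> y * v x))"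
    by (subst sum.swap) (simp add: weight_sym)
  also have "\<dots> - (\<Sum>x\<in>N. \<Sum>y\<in>N. \<omega> x y * (\<psi> x * v x)) = (\<Sum>x\<in>N. v x * (\<Sum>y\<in>N. \<omega> x y * (\<psi> y - \<psi> x)))"
    by (simp add: algebra_simps sum_subtractf sum_distrib_left)
  also have "\<dots> = (\<Sum>x\<in>N. v x * \<mu> x * laplacian \<mu> \<omega> \<psi> x)"
  proof (rule sum.cong)
    fix x assume "x \<in> N"
    have "\<mu> x * laplacian \<mu> \<omega> \<psi> x = (\<Sum>y\<in>?M x. \<omega> x y * (\<psi> y - \<psi> x))"
      using N(1) lf by (intro laplacian_eq_sum) auto
    also have "\<dots> = (\<Sum>y\<in>N. \<omega> x y * (\<psi> y - \<psi> x))"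
    proof (rule sum.mono_neutral_right)
      show "\<forall>y\<in>?M x - N. \<omega> x y * (\<psi> y - \<psi> x) = 0"
      proof
        fix y assume y: "y \<in> ?M x - N"
        then have "x \<notin> K" by (auto simp: N_def)
        with y \<psi>N K(2) show "\<omega> x y * (\<psi> y - \<psi> x) = 0" by simp
      qed
    qed (use N(1) lf in auto)
    finally show "v x * (\<Sum>y\<in>N. \<omega> x y * (\<psi> y - \<psi> x)) = v x * \<mu> x * laplacian \<mu> \<omega> \<psi> x"
      by simp
  qed simp
  finally show thesis using that N by blast
qed

section \<open>Distance spheres and the exponential weight\<close>

lemma set_dist_attained:
  assumes "connected_graph \<omega>" "finite \<Omega>" "\<Omega> \<noteq> {}"
  shows "\<exists>p\<in>\<Omega>. (adj \<omega> ^^ set_dist \<omega> \<Omega> x) x p"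
proof -
  have "set_dist \<omega> \<Omega> x \<in> comb_dist \<omega> x ` \<Omega>"
    unfolding set_dist_def using assms by (intro Min_in) auto
  then obtain p where p: "p \<in> \<Omega>" "set_dist \<omega> \<Omega> x = comb_dist \<omega> x p" by blast
  have "(adj \<omega> ^^ comb_dist \<omega> x p) x p"
    using assms(1) unfolding comb_dist_def connected_graph_def by (metis LeastI_ex)
  with p show ?thesis by auto
qed

lemma set_dist_le:
  assumes "finite \<Omega>" "p \<in> \<Omega>" "(adj \<omega> ^^ n) x p"
  shows "set_dist \<omega> \<Omega> x \<le> n"
proof -
  have "set_dist \<omega> \<Omega> x \<le> comb_dist \<omega> x p"
    unfolding set_dist_def using assms by (intro Min_le) auto
  also have "\<dots> \<le> n" unfolding comb_dist_def by (rule Least_le) (fact assms(3))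
  finally show ?thesis .
qed

lemma set_dist_adj:
  assumes "connected_graph \<omega>" "finite \<Omega>" "\<Omega> \<noteq> {}" "adj \<omega> x y"
  shows "set_dist \<omega> \<Omega> y \<le> set_dist \<omega> \<Omega> x + 1"
proof -
  obtain p where "p \<in> \<Omega>" "(adj \<omega> ^^ set_dist \<omega> \<Omega> x) x p"
    using set_dist_attained[OF assms(1-3)] by blast
  then have "p \<in> \<Omega>" "(adj \<omega> ^^ Suc (set_dist \<omega> \<Omega> x)) y p"
    using adj_sym[OF assms(4)] relpowp_Suc_I2[of "adj \<omega>" y x] by blast+
  then show ?thesis
    using set_dist_le[OF assms(2)] by simp
qed

lemma finite_dist_sphere:
  assumes "\<And>x. finite {y. adj \<omega> x y}" "connected_graph \<omega>" "finite \<Omega>" "\<Omega> \<noteq> {}"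
  shows "finite (dist_sphere \<omega> \<Omega> r)"
proof -
  have fin: "finite {x. (adj \<omega> ^^ n) x p}" for n p
  proof (induction n)
    case (Suc n)
    have "{x. (adj \<omega> ^^ Suc n) x p} \<subseteq> (\<Union>z\<in>{z. (adj \<omega> ^^ n) z p}. {x. adj \<omega> z x})"
      by (blast elim: relpowp_Suc_E2 intro: adj_sym)
    then show ?case using Suc assms(1) by (meson finite_UN finite_subset)
  qed simp
  have "dist_sphere \<omega> \<Omega> r \<subseteq> (\<Union>p\<in>\<Omega>. {x. (adj \<omega> ^^ r) x p})"
    using set_dist_attained[OF assms(2-4)] by (auto simp: dist_sphere_def)
  then show ?thesis using fin assms(3) by (meson finite_UN finite_subset)
qed

lemma sphere_measure_nonneg: "0 \<le> sphere_measure \<mu> \<omega> \<Omega> r"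
  using measure_pos by (auto simp: sphere_measure_def less_imp_le intro!: infsum_nonneg)

lemma exp_weight_nonneg:
  assumes "summable (\<lambda>r. sphere_measure \<mu> \<omega> \<Omega> r * exp (- a * real r))"
  shows "0 \<le> exp_weight \<mu> \<omega> \<Omega> a x"
proof -
  have "0 \<le> (\<Sum>r. sphere_measure \<mu> \<omega> \<Omega> r * exp (- a * real r))"
    using assms sphere_measure_nonneg by (intro suminf_nonneg) auto
  then show ?thesis by (simp add: exp_weight_def)
qed

text \<open>
  Grouped by spheres, the mass of \<open>F\<close> is bounded by the series that normalises the weight.
\<close>

lemma exp_weight_mass_le_1:
  assumes sph: "\<And>r. finite (dist_sphere \<omega> \<Omega> r)" and "finite F"
    and sm: "summable (\<lambda>r. sphere_measure \<mu> \<omega> \<Omega> r * exp (- a * real r))"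
  shows "(\<Sum>x\<in>F. exp_weight \<mu> \<omega> \<Omega> a x * \<mu> x) \<le> 1"
proof -
  let ?r = "set_dist \<omega> \<Omega>"
  let ?Z = "\<Sum>r. sphere_measure \<mu> \<omega> \<Omega> r * exp (- a * real r)"
  have S: "sphere_measure \<mu> \<omega> \<Omega> r = (\<Sum>x\<in>dist_sphere \<omega> \<Omega> r. \<mu> x)" for r
    using sph by (simp add: sphere_measure_def)
  have S0: "0 \<le> sphere_measure \<mu> \<omega> \<Omega> r * exp (- a * real r)" for r
    using sphere_measure_nonneg by simp
  have Z: "0 \<le> ?Z" using sm S0 by (rule suminf_nonneg)
  have "(\<Sum>x\<in>F. exp (- a * real (?r x)) * \<mu> x)
      = (\<Sum>r\<in>?r ` F. \<Sum>x\<in>{x \<in> F. ?r x = r}. exp (- a * real (?r x)) * \<mu> x)"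
    using \<open>finite F\<close> by (rule sum.image_gen)
  also have "\<dots> \<le> (\<Sum>r\<in>?r ` F. sphere_measure \<mu> \<omega> \<Omega> r * exp (- a * real r))"
  proof (rule sum_mono)
    fix r
    have "(\<Sum>x\<in>{x \<in> F. ?r x = r}. exp (- a * real (?r x)) * \<mu> x)
        = (\<Sum>x\<in>{x \<in> F. ?r x = r}. \<mu> x) * exp (- a * real r)"
      by (simp add: sum_distrib_left mult.commute)
    also have "\<dots> \<le> sphere_measure \<mu> \<omega> \<Omega> r * exp (- a * real r)"
      unfolding S using sph measure_pos
      by (intro mult_right_mono sum_mono2) (auto simp: dist_sphere_def less_imp_le)
    finally show "(\<Sum>x\<in>{x \<in> F. ?r x = r}. exp (- a * real (?r x)) * \<mu> x)
        \<le> sphere_measure \<mu> \<omega> \<Omega> r * exp (- a * real r)" .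
  qed
  also have "\<dots> \<le> ?Z" using \<open>finite F\<close> sm S0 by (intro sum_le_suminf) auto
  finally have "inverse ?Z * (\<Sum>x\<in>F. exp (- a * real (?r x)) * \<mu> x) \<le> inverse ?Z * ?Z"
    using Z by (intro mult_left_mono) auto
  also have "\<dots> \<le> 1" by (cases "?Z = 0") auto
  finally show ?thesis by (simp add: exp_weight_def sum_distrib_left mult.assoc)
qed

text \<open>
  Crossing an edge multiplies the weight by at most \<open>exp a\<close>, and the weight decreases only when
  the edge leads to the next outer sphere.
\<close>

lemma exp_weight_adj:
  assumes "connected_graph \<omega>" "finite \<Omega>" "\<Omega> \<noteq> {}" "0 \<le> a" "adj \<omega> x y"
    and sm: "summable (\<lambda>r. sphere_measure \<mu> \<omega> \<Omega> r * exp (- a * real r))"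
  shows "exp_weight \<mu> \<omega> \<Omega> a y \<le> exp a * exp_weight \<mu> \<omega> \<Omega> a x"
    and "set_dist \<omega> \<Omega> y \<noteq> set_dist \<omega> \<Omega> x + 1 \<Longrightarrow>
      exp_weight \<mu> \<omega> \<Omega> a x \<le> exp_weight \<mu> \<omega> \<Omega> a y"
proof -
  let ?Z = "inverse (\<Sum>r. sphere_measure \<mu> \<omega> \<Omega> r * exp (- a * real r))"
  have Z: "0 \<le> ?Z"
    using exp_weight_nonneg[OF sm, of x] by (simp add: exp_weight_def zero_le_mult_iff)
  have x: "set_dist \<omega> \<Omega> x \<le> set_dist \<omega> \<Omega> y + 1"
    and y: "set_dist \<omega> \<Omega> y \<le> set_dist \<omega> \<Omega> x + 1"
    using set_dist_adj[OF assms(1-3)] assms(5) adj_sym by blast+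
  have "a * real (set_dist \<omega> \<Omega> x) \<le> a * (real (set_dist \<omega> \<Omega> y) + 1)"
    using x assms(4) by (intro mult_left_mono) auto
  then have "exp (- a * real (set_dist \<omega> \<Omega> y)) \<le> exp a * exp (- a * real (set_dist \<omega> \<Omega> x))"
    by (simp add: mult_exp_exp algebra_simps)
  then have "?Z * exp (- a * real (set_dist \<omega> \<Omega> y))
      \<le> ?Z * (exp a * exp (- a * real (set_dist \<omega> \<Omega> x)))"
    using Z by (rule mult_left_mono)
  then show "exp_weight \<mu> \<omega> \<Omega> a y \<le> exp a * exp_weight \<mu> \<omega> \<Omega> a x"
    by (simp add: exp_weight_def mult_ac)
  assume "set_dist \<omega> \<Omega> y \<noteq> set_dist \<omega> \<Omega> x + 1"
  with y have "a * real (set_dist \<omega> \<Omega> y) \<le> a * real (set_dist \<omega> \<Omega> x)"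
    using assms(4) by (intro mult_left_mono) auto
  then show "exp_weight \<mu> \<omega> \<Omega> a x \<le> exp_weight \<mu> \<omega> \<Omega> a y"
    using Z unfolding exp_weight_def by (intro mult_left_mono) auto
qed

section \<open>The truncated weighted mass\<close>

text \<open>
  The difference of \<open>\<eta> * \<phi>\<close> along an edge splits as
  \<open>\<eta> x * (\<phi> y - \<phi> x) + \<phi> y * (\<eta> y - \<eta> x)\<close>. The first part is negative only on outer edges and
  is controlled by the outer degree; in the second, \<open>\<phi> y \<le> exp a * \<phi> x\<close> and the Lipschitz bound
  of the cutoff leave the mean jump.
\<close>

lemma laplacian_cutoff_exp_weight_ge:
  assumes d: "pseudo_metric d" "property_PM \<mu> \<omega> d"
    and C0: "\<And>x. 1 / \<mu> x * (\<Sum>\<^sub>\<infinity>y. \<omega> x y * d x y) \<le> C0"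
    and \<Omega>: "connected_graph \<omega>" "finite \<Omega>" "\<Omega> \<noteq> {}" and "0 \<le> a"
    and l: "\<And>x. outer_degree \<mu> \<omega> \<Omega> x \<le> l" and "R > 0"
    and sm: "summable (\<lambda>r. sphere_measure \<mu> \<omega> \<Omega> r * exp (- a * real r))"
  shows "laplacian \<mu> \<omega> (\<lambda>x. cutoff d q R x * exp_weight \<mu> \<omega> \<Omega> a x) x
    \<ge> - l * (cutoff d q R x * exp_weight \<mu> \<omega> \<Omega> a x) - exp a * C0 / R * exp_weight \<mu> \<omega> \<Omega> a x"
proof -
  let ?\<phi> = "exp_weight \<mu> \<omega> \<Omega> a" and ?\<eta> = "cutoff d q R"
  let ?N = "{y. adj \<omega> x y}" and ?S = "dist_sphere \<omega> \<Omega> (set_dist \<omega> \<Omega> x + 1)"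
  (* indicator of the outer sphere, which turns the outer degree into a sum over all neighbours *)
  define i :: "'a \<Rightarrow> real" where "i y = (if y \<in> ?S then 1 else 0)" for y
  have N: "finite ?N" using locally_finite[OF d(2)] .
  have \<phi>: "0 \<le> ?\<phi> y" for y by (rule exp_weight_nonneg[OF sm])
  have \<eta>: "0 \<le> ?\<eta> y" for y using cutoff_bounds[OF d(1) \<open>R > 0\<close>] by blast
  have D: "(\<Sum>y\<in>?N \<inter> ?S. \<omega> x y) \<le> l * \<mu> x"
    using l[of x] measure_pos[of x] infsum_weight_eq_sum[OF N order_refl, of "\<lambda>_. 1"]
    by (simp add: outer_degree_def field_simps)
  have E: "(\<Sum>y\<in>?N. \<omega> x y * d x y) \<le> C0 * \<mu> x"
    using C0[of x] measure_pos[of x] infsum_weight_eq_sum[OF N order_refl, of "d x" UNIV]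
    by (simp add: field_simps)
  have "- l * \<mu> x * (?\<eta> x * ?\<phi> x) - exp a / R * ?\<phi> x * (C0 * \<mu> x)
      \<le> - (?\<eta> x * ?\<phi> x) * (\<Sum>y\<in>?N \<inter> ?S. \<omega> x y)
         - exp a / R * ?\<phi> x * (\<Sum>y\<in>?N. \<omega> x y * d x y)"
  proof -
    have "(?\<eta> x * ?\<phi> x) * (\<Sum>y\<in>?N \<inter> ?S. \<omega> x y) \<le> (?\<eta> x * ?\<phi> x) * (l * \<mu> x)"
      using \<phi> \<eta> D by (intro mult_left_mono) auto
    moreover have "exp a / R * ?\<phi> x * (\<Sum>y\<in>?N. \<omega> x y * d x y) \<le> exp a / R * ?\<phi> x * (C0 * \<mu> x)"
      using \<phi> E \<open>R > 0\<close> by (intro mult_left_mono) auto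
    ultimately show ?thesis by (simp add: mult_ac)
  qed
  also have "\<dots> = (\<Sum>y\<in>?N. \<omega> x y *
      (- (?\<eta> x * ?\<phi> x) * i y - exp a * ?\<phi> x * (d x y / R)))"
  proof -
    have "(\<Sum>y\<in>?N \<inter> ?S. \<omega> x y) = (\<Sum>y\<in>?N. \<omega> x y * i y)"
      unfolding sum.inter_restrict[OF N] by (intro sum.cong) (auto simp: i_def)
    then show ?thesis
      by (simp only:) (simp add: right_diff_distrib sum_subtractf sum_distrib_left sum_negf mult_ac)
  qed
  also have "\<dots> \<le> (\<Sum>y\<in>?N. \<omega> x y * (?\<eta> y * ?\<phi> y - ?\<eta> x * ?\<phi> x))"
  proof (intro sum_mono mult_left_mono weight_nonneg)
    fix y assume "y \<in> ?N"
    then have xy: "adj \<omega> x y" by simp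
    have near: "?\<phi> y \<le> exp a * ?\<phi> x" using exp_weight_adj(1)[OF \<Omega> \<open>0 \<le> a\<close> xy sm] .
    have "- ?\<phi> x * i y \<le> ?\<phi> y - ?\<phi> x"
      using exp_weight_adj(2)[OF \<Omega> \<open>0 \<le> a\<close> xy sm] \<phi>[of y] by (auto simp: dist_sphere_def i_def)
    then have 1: "?\<eta> x * (- ?\<phi> x * i y) \<le> ?\<eta> x * (?\<phi> y - ?\<phi> x)"
      using \<eta> by (rule mult_left_mono)
    have dR: "0 \<le> d x y / R" using d(1) \<open>R > 0\<close> by (simp add: pseudo_metric_def)
    have "- (exp a * ?\<phi> x) * (d x y / R) \<le> - ?\<phi> y * (d x y / R)"
      using near dR by (intro mult_right_mono) auto
    also have "\<dots> \<le> ?\<phi> y * (?\<eta> y - ?\<eta> x)"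
    proof -
      have "?\<phi> y * (- (d x y / R)) \<le> ?\<phi> y * (?\<eta> y - ?\<eta> x)"
        using cutoff_lipschitz[OF d(1) \<open>R > 0\<close>, of q x y] \<phi> by (intro mult_left_mono) auto
      then show ?thesis by simp
    qed
    finally show "- (?\<eta> x * ?\<phi> x) * i y - exp a * ?\<phi> x * (d x y / R)
        \<le> ?\<eta> y * ?\<phi> y - ?\<eta> x * ?\<phi> x"
      using 1 by (simp add: algebra_simps)
  qed
  also have "\<dots> = \<mu> x * laplacian \<mu> \<omega> (\<lambda>x. ?\<eta> x * ?\<phi> x) x"
    by (rule laplacian_eq_sum[symmetric, OF N order_refl])
  finally have "\<mu> x * (- l * (?\<eta> x * ?\<phi> x) - exp a * C0 / R * ?\<phi> x)
      \<le> \<mu> x * laplacian \<mu> \<omega> (\<lambda>x. ?\<eta> x * ?\<phi> x) x"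
    by (simp add: algebra_simps)
  then show ?thesis using measure_pos[of x] by (simp only: mult_le_cancel_left_pos)
qed

text \<open>
  Kaplan's inequality for one time slice \<open>v\<close> of the solution. Because the error term of
  \<open>laplacian_cutoff_exp_weight_ge\<close> is proportional to \<open>\<phi>\<close>, whose total mass is at most one, it
  contributes at most a multiple of \<open>M / R\<close>, although the Green sum extends beyond the support
  of the cutoff.
\<close>

lemma truncated_mass_growth:
  fixes d :: "'a \<Rightarrow> 'a \<Rightarrow> real" and q :: 'a and \<Omega> :: "'a set" and a R :: real
  assumes d: "pseudo_metric d" "property_PM \<mu> \<omega> d"
    and C0: "0 \<le> C0" "\<And>x. 1 / \<mu> x * (\<Sum>\<^sub>\<infinity>y. \<omega> x y * d x y) \<le> C0"
    and \<Omega>: "connected_graph \<omega>" "finite \<Omega>" "\<Omega> \<noteq> {}" and "0 \<le> a"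
    and l: "\<And>x. outer_degree \<mu> \<omega> \<Omega> x \<le> l" and "R > 0"
    and sm: "summable (\<lambda>r. sphere_measure \<mu> \<omega> \<Omega> r * exp (- a * real r))"
    and f: "convex_on {0..} f" "f 0 = 0"
    and v: "\<And>x. 0 \<le> v x" "\<And>x. v x \<le> M"
  defines "K \<equiv> {x. d x q < R}"
    and "w \<equiv> \<lambda>x. cutoff d q R x * (exp_weight \<mu> \<omega> \<Omega> a x * \<mu> x)"
  shows "f (\<Sum>x\<in>K. w x * v x) - l * (\<Sum>x\<in>K. w x * v x) - exp a * C0 / R * M
    \<le> (\<Sum>x\<in>K. w x * (laplacian \<mu> \<omega> v x + f (v x)))"
proof -
  let ?\<phi> = "exp_weight \<mu> \<omega> \<Omega> a" and ?\<eta> = "cutoff d q R"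
  let ?\<psi> = "\<lambda>x. ?\<eta> x * ?\<phi> x" and ?c = "exp a * C0 / R"
  note lf = locally_finite[OF d(2)]
  have mass: "(\<Sum>x\<in>F. ?\<phi> x * \<mu> x) \<le> 1" if "finite F" for F
    using exp_weight_mass_le_1[OF finite_dist_sphere[OF lf \<Omega>] that sm] .
  have \<phi>\<mu>: "0 \<le> ?\<phi> x * \<mu> x" for x
    using exp_weight_nonneg[OF sm, of x] measure_pos[of x] by simp
  have w: "0 \<le> w x" "w x \<le> ?\<phi> x * \<mu> x" for x
    unfolding w_def using cutoff_bounds[OF d(1) \<open>R > 0\<close>, of q x] \<phi>\<mu>[of x]
    by (auto intro: mult_left_le_one_le)
  have K: "finite K" using d(2) \<open>R > 0\<close> by (simp add: K_def property_PM_def)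
  have \<eta>K: "?\<eta> x = 0" if "x \<notin> K" for x
    using that \<open>R > 0\<close> by (simp add: cutoff_def K_def not_less)
  obtain N where N: "finite N" "K \<subseteq> N"
    and green: "(\<Sum>x\<in>K. ?\<psi> x * \<mu> x * laplacian \<mu> \<omega> v x)
      = (\<Sum>x\<in>N. v x * \<mu> x * laplacian \<mu> \<omega> ?\<psi> x)"
    using green_formula_finite_support[OF lf K, of ?\<psi> v] \<eta>K by auto
  have "0 \<le> M" using v by (rule order_trans)
  have "(\<Sum>x\<in>K. w x * v x) = (\<Sum>x\<in>N. w x * v x)"
    using N \<eta>K by (intro sum.mono_neutral_left) (auto simp: w_def)
  moreover have "?c * (\<Sum>x\<in>N. v x * (?\<phi> x * \<mu> x)) \<le> ?c * M"
  proof (rule mult_left_mono)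
    have "(\<Sum>x\<in>N. v x * (?\<phi> x * \<mu> x)) \<le> (\<Sum>x\<in>N. M * (?\<phi> x * \<mu> x))"
      using v \<phi>\<mu> by (intro sum_mono mult_right_mono) auto
    also have "\<dots> = M * (\<Sum>x\<in>N. ?\<phi> x * \<mu> x)" by (simp add: sum_distrib_left)
    also have "\<dots> \<le> M" using mass[OF N(1)] \<open>0 \<le> M\<close> by (simp add: mult_left_le)
    finally show "(\<Sum>x\<in>N. v x * (?\<phi> x * \<mu> x)) \<le> M" .
  qed (use C0(1) \<open>R > 0\<close> in simp)
  ultimately have "- l * (\<Sum>x\<in>K. w x * v x) - ?c * M
      \<le> - l * (\<Sum>x\<in>N. w x * v x) - ?c * (\<Sum>x\<in>N. v x * (?\<phi> x * \<mu> x))"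
    by simp
  also have "\<dots> = (\<Sum>x\<in>N. (v x * \<mu> x) * (- l * ?\<psi> x - ?c * ?\<phi> x))"
    by (simp add: w_def right_diff_distrib sum_subtractf sum_distrib_left sum_negf mult_ac)
  also have "\<dots> \<le> (\<Sum>x\<in>N. (v x * \<mu> x) * laplacian \<mu> \<omega> ?\<psi> x)"
    using v(1) measure_pos
    by (intro sum_mono mult_left_mono
        laplacian_cutoff_exp_weight_ge[OF d C0(2) \<Omega> \<open>0 \<le> a\<close> l \<open>R > 0\<close> sm])
      (simp add: less_imp_le)
  also have "\<dots> = (\<Sum>x\<in>K. w x * laplacian \<mu> \<omega> v x)"
    unfolding green[symmetric] by (simp add: w_def mult_ac)
  finally have diffusion: "- l * (\<Sum>x\<in>K. w x * v x) - ?c * M \<le> (\<Sum>x\<in>K. w x * laplacian \<mu> \<omega> v x)" .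
  have "f (\<Sum>x\<in>K. w x * v x) \<le> (\<Sum>x\<in>K. w x * f (v x))"
  proof (rule convex_on_subprobability_sum[OF f K])
    show "(\<Sum>x\<in>K. w x) \<le> 1" using sum_mono[OF w(2)] mass[OF K] by (rule order_trans)
  qed (use w v in auto)
  with diffusion show ?thesis by (simp add: distrib_left sum.distrib)
qed

end

section \<open>Blow-up in finite time\<close>

theorem theorem4p4:
  fixes \<mu> :: "'a \<Rightarrow> real"
    and \<omega> :: "'a \<Rightarrow> 'a \<Rightarrow> real"
    and f :: "real \<Rightarrow> real"
    and \<Omega> :: "'a set"
    and a l :: real
    and u0 :: "'a \<Rightarrow> real"
    and u :: "'a \<Rightarrow> real \<Rightarrow> real"
    and T :: ereal
  assumes "weighted_graph \<mu> \<omega>"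
    and "connected_graph \<omega>"
    and "\<exists>d. pseudo_metric d \<and> property_PM \<mu> \<omega> d"
    and "\<forall>v\<ge>0. f v \<ge> 0"
    and "locally_lipschitz_on {0..} f"
    and "convex_on {0..} f"
    and "f 0 = 0"
    and "\<forall>v>0. f v > 0"
    and "set_integrable lborel {1..} (\<lambda>v. 1 / f v)"
    and "filterlim (\<lambda>v. f v / v) at_top at_top"
    and "\<Omega> \<noteq> {}"
    and "finite \<Omega>"
    and "bdd_above (range (outer_degree \<mu> \<omega> \<Omega>))"
    and "bdd_above (range (inner_degree \<mu> \<omega> \<Omega>))"
    and "a > 0"
    and "summable (\<lambda>r. sphere_measure \<mu> \<omega> \<Omega> r * exp (- a * real r))"
    and "\<forall>x. u0 x \<ge> 0"
    and "u0 \<in> ell_inf"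
    and "\<exists>x. u0 x \<noteq> 0"
    and "is_maximal_solution \<mu> \<omega> f u0 T u"
    and "l \<ge> (SUP x. outer_degree \<mu> \<omega> \<Omega> x)"
    and "\<forall>t0 T'. 0 < t0 \<and> t0 < T' \<and> ereal T' < T \<longrightarrow>
           (\<lambda>x. exp_weight \<mu> \<omega> \<Omega> a x * (SUP t\<in>{t0<..<T'}. \<bar>deriv (u x) t\<bar>)) \<in> ell1 \<mu>"
    and "(\<Sum>\<^sub>\<infinity>x. u0 x * exp_weight \<mu> \<omega> \<Omega> a x * \<mu> x) > s_zero f l"
  shows "blows_up_in_finite_time T u"
proof -
  interpret weighted_graph \<mu> \<omega> by fact
  note sol = \<open>is_maximal_solution \<mu> \<omega> f u0 T u\<close>[unfolded is_maximal_solution_def is_solution_def]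
  show ?thesis
  proof (cases "T = \<infinity>")
    case False
    then have T: "0 < T" "T < \<infinity>"
      and blowup: "filterlim (\<lambda>t. sup_norm (\<lambda>x. u x t)) at_top (at_left (real_of_ereal T))"
      using sol by (auto simp: global_in_time_def)
    have "(\<lambda>x. u x t) \<in> ell_inf" if "0 < t" "ereal t < T" for t
    proof -
      have "bounded ((\<lambda>(x, t). u x t) ` (UNIV \<times> {0..t}))" using sol that by blast
      moreover have "range (\<lambda>x. u x t) \<subseteq> (\<lambda>(x, t). u x t) ` (UNIV \<times> {0..t})"
        using that by force
      ultimately show ?thesis unfolding ell_inf_def using bounded_subset by blast
    qed
    with T blowup show ?thesis by (simp add: blows_up_in_finite_time_def)
  next
    case True
    obtain d where d: "pseudo_metric d" "property_PM \<mu> \<omega> d"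
      using \<open>\<exists>d. pseudo_metric d \<and> property_PM \<mu> \<omega> d\<close> by blast
    then obtain C0 where C0: "0 < C0" "\<And>x. 1 / \<mu> x * (\<Sum>\<^sub>\<infinity>y. \<omega> x y * d x y) \<le> C0"
      unfolding property_PM_def by blast
    have l: "outer_degree \<mu> \<omega> \<Omega> x \<le> l" for x
      using cSUP_upper[OF UNIV_I \<open>bdd_above (range (outer_degree \<mu> \<omega> \<Omega>))\<close>, of x]
        \<open>(SUP x. outer_degree \<mu> \<omega> \<Omega> x) \<le> l\<close> by linarith
    have "0 \<le> outer_degree \<mu> \<omega> \<Omega> x" for x
      using measure_pos[of x] weight_nonneg by (simp add: outer_degree_def infsum_nonneg)
    then have "0 \<le> l" using l order_trans by blast
    let ?g = "\<lambda>x. u0 x * exp_weight \<mu> \<omega> \<Omega> a x * \<mu> x"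
    have "\<exists>c\<in>{v. 0 < v \<and> l < f v / v}. c < (\<Sum>\<^sub>\<infinity>x. ?g x)"
    proof (rule cInf_lessD)
      have "\<forall>\<^sub>F v in at_top. 0 < v \<and> l < f v / v"
        using \<open>filterlim (\<lambda>v. f v / v) at_top at_top\<close> eventually_gt_at_top[of 0]
        by (simp add: filterlim_at_top_dense eventually_conj)
      then show "{v. 0 < v \<and> l < f v / v} \<noteq> {}"
        using eventually_happens' trivial_limit_at_top_linorder by blast
    qed (use \<open>s_zero f l < (\<Sum>\<^sub>\<infinity>x. ?g x)\<close> in \<open>simp add: s_zero_def\<close>)
    then obtain c where c: "0 < c" "l < f c / c" "c < (\<Sum>\<^sub>\<infinity>x. ?g x)" by blast
    obtain k where k: "0 < k" "\<And>v. c \<le> v \<Longrightarrow> f c \<le> f v \<and> k * f v \<le> f v - l * v"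
      using convex_reaction_beats_linear[OF \<open>convex_on {0..} f\<close> \<open>f 0 = 0\<close> c(1,2) \<open>0 \<le> l\<close>] by blast
    have "continuous_on {0..} f"
      using \<open>locally_lipschitz_on {0..} f\<close> by (rule continuous_on_locally_lipschitz)
    from osgood_no_long_solution[OF this \<open>\<forall>v>0. f v > 0\<close>
        \<open>set_integrable lborel {1..} (\<lambda>v. 1 / f v)\<close> c(1) half_gt_zero[OF k(1)]]
    (* the rate k / 2 leaves the other half of the reaction term to absorb the truncation error *)
    obtain \<tau> where \<tau>: "0 < \<tau>"
      and no_long: "\<And>y. \<lbrakk>continuous_on {0..\<tau>} y; c < y 0;
            \<And>t. 0 < t \<Longrightarrow> t < \<tau> \<Longrightarrow>
              \<exists>D. (y has_real_derivative D) (at t) \<and> (c < y t \<longrightarrow> k / 2 * f (y t) \<le> D)\<rbrakk> \<Longrightarrow> False"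
      by blast
    have "bounded ((\<lambda>(x, t). u x t) ` (UNIV \<times> {0..\<tau>}))" using sol \<tau> True by simp
    then obtain M where "\<forall>z\<in>(\<lambda>(x, t). u x t) ` (UNIV \<times> {0..\<tau>}). \<bar>z\<bar> \<le> M"
      by (auto simp: bounded_real)
    then have M: "u x t \<le> M" if "0 < t" "t < \<tau>" for x t
      using that by (force simp: abs_le_iff)
    have "f c > 0" using \<open>\<forall>v>0. f v > 0\<close> c(1) by blast
    have fin: "finite {x. d x q < R}" if "0 < R" for q R
      using d(2) that by (simp add: property_PM_def)
    have g0: "0 \<le> ?g x" for x
      using \<open>\<forall>x. u0 x \<ge> 0\<close> measure_pos[of x]
        exp_weight_nonneg[OF \<open>summable (\<lambda>r. sphere_measure \<mu> \<omega> \<Omega> r * exp (- a * real r))\<close>, of x]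
      by simp
    (* any vertex will do as the centre of the truncation balls *)
    define q :: 'a where "q = undefined"
    have "\<forall>\<^sub>F R in at_top. 0 < R \<and> exp a * C0 * M / (k / 2 * f c) \<le> R
        \<and> c < (\<Sum>x | d x q < R. cutoff d q R x * ?g x)"
      using eventually_truncated_sum_greater[OF g0 less_imp_le[OF c(1)] c(3) fin]
      by (intro eventually_conj eventually_gt_at_top eventually_ge_at_top)
    then obtain R where R: "0 < R" "exp a * C0 * M / (k / 2 * f c) \<le> R"
        "c < (\<Sum>x | d x q < R. cutoff d q R x * ?g x)"
      using eventually_happens' trivial_limit_at_top_linorder by blast
    have error: "exp a * C0 / R * M \<le> k / 2 * f c"
      using R(1,2) \<open>0 < k\<close> \<open>0 < f c\<close> by (simp add: field_simps)
    define w where "w x = cutoff d q R x * (exp_weight \<mu> \<omega> \<Omega> a x * \<mu> x)" for x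
    define K where "K = {x. d x q < R}"
    define y where "y t = (\<Sum>x\<in>K. w x * u x t)" for t
    have False
    proof (rule no_long)
      show "continuous_on {0..\<tau>} y"
        unfolding y_def
      proof (intro continuous_intros)
        show "continuous_on {0..\<tau>} (u x)" for x
          using sol by (auto intro: continuous_on_subset[of "{t. 0 \<le> t \<and> ereal t < T}"] simp: True)
      qed
      show "c < y 0" using R(3) sol by (simp add: y_def w_def K_def mult_ac)
      fix t assume t: "0 < t" "t < \<tau>"
      have "u x differentiable at t" for x
      proof -
        have "u x C1_differentiable_on {t. 0 < t \<and> ereal t < T}" using sol by blast
        then show ?thesis using t(1) by (simp add: C1_differentiable_on_eq True)
      qed
      then have "(u x has_real_derivative deriv (u x) t) (at t)" for x
        by (simp add: DERIV_deriv_iff_real_differentiable)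
      moreover have "deriv (u x) t = laplacian \<mu> \<omega> (\<lambda>x. u x t) x + f (u x t)" for x
        using sol t by (simp add: True algebra_simps)
      ultimately have "(y has_real_derivative (\<Sum>x\<in>K. w x * (laplacian \<mu> \<omega> (\<lambda>x. u x t) x + f (u x t)))) (at t)"
        unfolding y_def by (intro DERIV_sum DERIV_cmult) simp
      moreover have "k / 2 * f (y t) \<le> (\<Sum>x\<in>K. w x * (laplacian \<mu> \<omega> (\<lambda>x. u x t) x + f (u x t)))"
        if "c < y t"
      proof -
        have "f c \<le> f (y t)" "k * f (y t) \<le> f (y t) - l * y t" using k(2) that by simp_all
        have "k / 2 * f (y t) \<le> f (y t) - l * y t - exp a * C0 / R * M"
        proof -
          have "k / 2 * f c \<le> k / 2 * f (y t)"
            using \<open>f c \<le> f (y t)\<close> \<open>0 < k\<close> by (intro mult_left_mono) auto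
          moreover have "k * f (y t) = k / 2 * f (y t) + k / 2 * f (y t)" by simp
          ultimately show ?thesis using error \<open>k * f (y t) \<le> f (y t) - l * y t\<close> by linarith
        qed
        also have "\<dots> \<le> (\<Sum>x\<in>K. w x * (laplacian \<mu> \<omega> (\<lambda>x. u x t) x + f (u x t)))"
          unfolding y_def w_def K_def
        proof (rule truncated_mass_growth[OF d less_imp_le[OF C0(1)] C0(2)
              \<open>connected_graph \<omega>\<close> \<open>finite \<Omega>\<close> \<open>\<Omega> \<noteq> {}\<close> less_imp_le[OF \<open>a > 0\<close>] l R(1)
              \<open>summable (\<lambda>r. sphere_measure \<mu> \<omega> \<Omega> r * exp (- a * real r))\<close>
              \<open>convex_on {0..} f\<close> \<open>f 0 = 0\<close>])
          show "0 \<le> u x t" "u x t \<le> M" for x using sol t M by (simp_all add: True)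
        qed
        finally show ?thesis .
      qed
      ultimately show "\<exists>D. (y has_real_derivative D) (at t) \<and> (c < y t \<longrightarrow> k / 2 * f (y t) \<le> D)"
        by blast
    qed
    then show ?thesis ..
  qed
qed

end
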